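(* For every H-PCL formula $p$, the sequent $p\vdash\lambda(p)$ is provable in PCL if and only if the contract automaton $\llbracket p\rrbracket$ admits agreement.
   Context: Contract automata: fix disjoint sets $\mathbb{R}$ (requests $a$) and $\mathbb{O}$ (offers $\overline a$), idle symbol $\Box$, $\Sigma=\mathbb{R}\cup\mathbb{O}\cup\{\Box\}$, $co$ swapping $a,\overline a$ and fixing $\Box$. $\vec a\in\Sigma^n$ is a request/offer on $\alpha$ if it is $\Box^{n_1}\alpha\Box^{n_2}$ with $\alpha\in\mathbb{R}$/$\mathbb{O}$, a match if $\Box^{n_1}\alpha\Box^{n_2}co(\alpha)\Box^{n_3}$; $\vec a\bowtie\vec b$ iff $\vec a$ is a request or offer on some $\alpha$ and $\vec b$ is respectively an offer or request on $co(\alpha)$. A CA of rank $n$ is $\langle Q,\vec q_0,A^r,A^o,T,F\rangle$, $Q=Q_1\times\cdots\times Q_n$, transition labels in $(A^r\cup A^o\cup\{\Box\})^n$ being requests, offers or matches, idle components not changing state; its language consists of label words of paths from $\vec q_0$ to $F$. Product of CAs of ranks $r_i$: states are concatenations, initial/final componentwise, transitions are either (i) a joint move of components $i<j$ with complementary labels, label $\Box^u\vec a_i\Box^v\vec a_j\Box^z$ padded to total rank, or (ii) a move of a single component $i$ padded by idles, allowed only if no other component has, in its current state, a transition with label complementary to $\vec a_i$. $\boxtimes$ (a-product) is the product of all rank-1 projections of the operands. Observable: non-idle entry for requests/offers, $\tau$ for matches; $\mathfrak{A}$ = words of rank $>1$ whose observable lies in $(\mathbb{O}\cup\{\tau\})^*$;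 a CA admits agreement iff its language meets $\mathfrak{A}$. H-PCL formulae: $p::=\bigwedge_{i\in I}\alpha_i$, $\alpha::=\bigwedge_{j\in J}a_j\mid(\bigwedge_{j\in J}a_j)\rightarrow b\mid(\bigwedge_{j\in J}a_j)\twoheadrightarrow b$, $|I|\ge2$, $|J|\ge1$, distinct $a_j$, $a_j\ne b$. $\lambda(p)$ is the conjunction of all atoms in $p$. Translation with $\mathcal{P}=\{q\cup\{\ast\}\mid q\subseteq J\}$: $\llbracket\bigwedge_i\alpha_i\rrbracket=\boxtimes_i\llbracket\alpha_i\rrbracket$; $\llbracket\bigwedge_j a_j\rrbracket$ has the single (initial and final) state $\{\ast\}$ and loops $(\{\ast\},\overline{a_j},\{\ast\})$; $\llbracket(\bigwedge_j a_j)\rightarrow b\rrbracket$ has states $\mathcal{P}$, initial $J\cup\{\ast\}$, final $\{\ast\}$, transitions $(J'\cup\{j\},a_j,J')$ ($j\in J$, $j\notin J'\in\mathcal P$) and $(\{\ast\},\overline b,\{\ast\})$; $\llbracket(\bigwedge_j a_j)\twoheadrightarrow b\rrbracket$ is the same but with loops $(q,\overline b,q)$ at every $q\in\mathcal{P}$ instead of only at $\{\ast\}$. PCL sequent calculus (formulae built from atoms, $\bot,\top,\neg,\vee,\wedge,\rightarrow,\twoheadrightarrow$): $id$: $\Gamma,p\vdash p$; $\wedge L1$: from $\Gamma,p\wedge q,p\vdash r$ infer $\Gamma,p\wedge q\vdash r$; $\wedge L2$: from $\Gamma,p\wedge q,q\vdash r$ infer $\Gamma,p\wedge q\vdash r$;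 $\wedge R$: from $\Gamma\vdash p$ and $\Gamma\vdash q$ infer $\Gamma\vdash p\wedge q$; $\vee L$: from $\Gamma,p\vee q,p\vdash r$ and $\Gamma,p\vee q,q\vdash r$ infer $\Gamma,p\vee q\vdash r$; $\vee R1/2$: from $\Gamma\vdash p$ (resp. $q$) infer $\Gamma\vdash p\vee q$; $cut$: from $\Gamma\vdash p$ and $\Gamma,p\vdash q$ infer $\Gamma\vdash q$; $\rightarrow L$: from $\Gamma,p\rightarrow q\vdash p$ and $\Gamma,p\rightarrow q,q\vdash r$ infer $\Gamma,p\rightarrow q\vdash r$; $\rightarrow R$: from $\Gamma,p\vdash q$ infer $\Gamma\vdash p\rightarrow q$; $\neg L$: from $\Gamma,\neg p\vdash p$ infer $\Gamma,\neg p\vdash r$; $\neg R$: from $\Gamma,p\vdash\bot$ infer $\Gamma\vdash\neg p$; $\bot L$: $\Gamma,\bot\vdash p$; $\top R$: $\Gamma\vdash\top$; $weakR$: from $\Gamma\vdash\bot$ infer $\Gamma\vdash p$; $Zero$: from $\Gamma\vdash q$ infer $\Gamma\vdash p\twoheadrightarrow q$; $Fix$: from $\Gamma,p\twoheadrightarrow q,r\vdash p$ and $\Gamma,p\twoheadrightarrow q,q\vdash r$ infer $\Gamma,p\twoheadrightarrow q\vdash r$; $PrePost$: from $\Gamma,p\twoheadrightarrow q,p'\vdash p$ and $\Gamma,p\twoheadrightarrow q,q\vdash q'$ infer $\Gamma,p\twoheadrightarrow q\vdash p'\twoheadrightarrow q'$. *)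

theory Defs
  imports Main
begin

section \<open>Contract automata\<close>

datatype 'a action = Req 'a | Off 'a | Idle

fun co :: "'a action \<Rightarrow> 'a action" where
  "co (Req a) = Off a"
| "co (Off a) = Req a"
| "co Idle = Idle"

type_synonym 'a label = "'a action list"

definition requests :: "'a action set" where
  "requests = range Req"

definition offers :: "'a action set" where
  "offers = range Off"

definition request_on :: "'a action \<Rightarrow> 'a label \<Rightarrow> bool" where
  "request_on \<alpha> v \<longleftrightarrow> \<alpha> \<in> requests \<and>
     (\<exists>n1 n2. v = replicate n1 Idle @ [\<alpha>] @ replicate n2 Idle)"

definition offer_on :: "'a action \<Rightarrow> 'a label \<Rightarrow> bool" where
  "offer_on \<alpha> v \<longleftrightarrow> \<alpha> \<in> offers \<and>
     (\<exists>n1 n2. v = replicate n1 Idle @ [\<alpha>] @ replicate n2 Idle)"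

text \<open>The action matched on is not the idle one; otherwise an all-idle vector would be a match.\<close>

definition match_on :: "'a action \<Rightarrow> 'a label \<Rightarrow> bool" where
  "match_on \<alpha> v \<longleftrightarrow> \<alpha> \<in> requests \<union> offers \<and>
     (\<exists>n1 n2 n3. v = replicate n1 Idle @ [\<alpha>] @ replicate n2 Idle @ [co \<alpha>] @ replicate n3 Idle)"

definition is_request :: "'a label \<Rightarrow> bool" where
  "is_request v \<longleftrightarrow> (\<exists>\<alpha>. request_on \<alpha> v)"

definition is_offer :: "'a label \<Rightarrow> bool" where
  "is_offer v \<longleftrightarrow> (\<exists>\<alpha>. offer_on \<alpha> v)"

definition is_match :: "'a label \<Rightarrow> bool" where
  "is_match v \<longleftrightarrow> (\<exists>\<alpha>. match_on \<alpha> v)"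

definition complementary :: "'a label \<Rightarrow> 'a label \<Rightarrow> bool"  (infix "\<bowtie>" 50) where
  "v \<bowtie> w \<longleftrightarrow> (\<exists>\<alpha>. request_on \<alpha> v \<and> offer_on (co \<alpha>) w \<or> offer_on \<alpha> v \<and> request_on (co \<alpha>) w)"

record ('s, 'a) ca =
  ca_rank :: nat
  ca_states :: "'s list set"
  ca_init :: "'s list"
  ca_requests :: "'a action set"
  ca_offers :: "'a action set"
  ca_trans :: "('s list \<times> 'a label \<times> 's list) set"
  ca_final :: "'s list set"

text \<open>
  The record type alone imposes no constraint; the following predicate singles out the contract
  automata.  The list \<open>Qs\<close> consists of the factors of the state space.
\<close>

definition is_ca :: "('s, 'a) ca \<Rightarrow> bool" where
  "is_ca A \<longleftrightarrow>
     (\<exists>Qs. length Qs = ca_rank A \<and> (\<forall>Q \<in> set Qs. finite Q) \<and> ca_states A = listset Qs) \<and>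
     ca_init A \<in> ca_states A \<and>
     finite (ca_requests A) \<and> ca_requests A \<subseteq> requests \<and>
     finite (ca_offers A) \<and> ca_offers A \<subseteq> offers \<and>
     ca_final A \<subseteq> ca_states A \<and>
     (\<forall>(q, v, q') \<in> ca_trans A.
        q \<in> ca_states A \<and> q' \<in> ca_states A \<and>
        length v = ca_rank A \<and> set v \<subseteq> ca_requests A \<union> ca_offers A \<union> {Idle} \<and>
        (is_request v \<or> is_offer v \<or> is_match v) \<and>
        (\<forall>i < ca_rank A. v ! i = Idle \<longrightarrow> q' ! i = q ! i))"

inductive ca_path :: "('s, 'a) ca \<Rightarrow> 's list \<Rightarrow> 'a label list \<Rightarrow> 's list \<Rightarrow> bool" for A where
  Nil: "ca_path A q [] q"
| Cons: "(q, v, q') \<in> ca_trans A \<Longrightarrow> ca_path A q' w q'' \<Longrightarrow> ca_path A q (v # w) q''"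

definition ca_language :: "('s, 'a) ca \<Rightarrow> 'a label list set" where
  "ca_language A = {w. \<exists>q \<in> ca_final A. ca_path A (ca_init A) w q}"

text \<open>
  In the product, \<open>qs\<close> is the list of the local states of the operands, and a
  global state is the concatenation \<open>concat qs\<close>.
\<close>

definition ca_product :: "('s, 'a) ca list \<Rightarrow> ('s, 'a) ca" where
  "ca_product As =
    \<lparr> ca_rank = (\<Sum>A\<leftarrow>As. ca_rank A),
      ca_states = concat ` listset (map ca_states As),
      ca_init = concat (map ca_init As),
      ca_requests = (\<Union>A \<in> set As. ca_requests A),
      ca_offers = (\<Union>A \<in> set As. ca_offers A),
      ca_trans =
        {(concat qs,
          replicate (\<Sum>k<i. ca_rank (As ! k)) Idle @ v @
          replicate (\<Sum>k=Suc i..<j. ca_rank (As ! k)) Idle @ w @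
          replicate (\<Sum>k=Suc j..<length As. ca_rank (As ! k)) Idle,
          concat (qs[i := q, j := q']))
         | qs i j v w q q'.
           qs \<in> listset (map ca_states As) \<and> i < j \<and> j < length As \<and>
           (qs ! i, v, q) \<in> ca_trans (As ! i) \<and> (qs ! j, w, q') \<in> ca_trans (As ! j) \<and> v \<bowtie> w} \<union>
        {(concat qs,
          replicate (\<Sum>k<i. ca_rank (As ! k)) Idle @ v @
          replicate (\<Sum>k=Suc i..<length As. ca_rank (As ! k)) Idle,
          concat (qs[i := q]))
         | qs i v q.
           qs \<in> listset (map ca_states As) \<and> i < length As \<and>
           (qs ! i, v, q) \<in> ca_trans (As ! i) \<and>
           (\<forall>j < length As. j \<noteq> i \<longrightarrow> (\<forall>w q'. (qs ! j, w, q') \<in> ca_trans (As ! j) \<longrightarrow> \<not> v \<bowtie> w))},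
      ca_final = concat ` listset (map ca_final As) \<rparr>"

definition ca_projection :: "nat \<Rightarrow> ('s, 'a) ca \<Rightarrow> ('s, 'a) ca" where
  "ca_projection i A =
    \<lparr> ca_rank = 1,
      ca_states = (\<lambda>q. [q ! i]) ` ca_states A,
      ca_init = [ca_init A ! i],
      ca_requests = {a \<in> ca_requests A. \<exists>(q, v, q') \<in> ca_trans A. v ! i = a},
      ca_offers = {a \<in> ca_offers A. \<exists>(q, v, q') \<in> ca_trans A. v ! i = a},
      ca_trans = {([q ! i], [v ! i], [q' ! i]) | q v q'. (q, v, q') \<in> ca_trans A \<and> v ! i \<noteq> Idle},
      ca_final = (\<lambda>q. [q ! i]) ` ca_final A \<rparr>"

text \<open>
  The projections are taken as a family, not as a set: two operands with equal
  projections contribute two components.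
\<close>

definition ca_aproduct :: "('s, 'a) ca list \<Rightarrow> ('s, 'a) ca" where
  "ca_aproduct As =
     ca_product (concat (map (\<lambda>A. map (\<lambda>i. ca_projection i A) [0..<ca_rank A]) As))"

section \<open>Agreement\<close>

datatype 'a obs = Act "'a action" | Tau

text \<open>Only meaningful on vectors that are requests, offers or matches.\<close>

definition observable :: "'a label \<Rightarrow> 'a obs" where
  "observable v = (if is_match v then Tau else Act (hd (filter (\<lambda>\<alpha>. \<alpha> \<noteq> Idle) v)))"

definition agreement :: "'a label list set" where
  "agreement =
     {w. (\<exists>n > 1. \<forall>v \<in> set w. length v = n) \<and>
         (\<forall>v \<in> set w. is_request v \<or> is_offer v \<or> is_match v) \<and>
         map observable w \<in> lists (Act ` offers \<union> {Tau})}"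

definition admits_agreement :: "('s, 'a) ca \<Rightarrow> bool" where
  "admits_agreement A \<longleftrightarrow> ca_language A \<inter> agreement \<noteq> {}"

section \<open>Propositional contract logic\<close>

datatype 'a form =
    Atom 'a
  | Bot
  | Top
  | Neg "'a form"
  | Or "'a form" "'a form"
  | And "'a form" "'a form"
  | Imp "'a form" "'a form"
  | CImp "'a form" "'a form"  \<comment> \<open>contractual implication\<close>

text \<open>
  The left-hand side of a sequent is a set, so exchange and contraction are implicit.  Read
  backwards from a finite left-hand side, the rules only produce finite ones.
\<close>

inductive pcl :: "'a form set \<Rightarrow> 'a form \<Rightarrow> bool"  (infix "\<turnstile>" 50) where
  Id: "insert p \<Gamma> \<turnstile> p"
| AndL1: "insert p (insert (And p q) \<Gamma>) \<turnstile> r \<Longrightarrow> insert (And p q) \<Gamma> \<turnstile> r"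
| AndL2: "insert q (insert (And p q) \<Gamma>) \<turnstile> r \<Longrightarrow> insert (And p q) \<Gamma> \<turnstile> r"
| AndR: "\<Gamma> \<turnstile> p \<Longrightarrow> \<Gamma> \<turnstile> q \<Longrightarrow> \<Gamma> \<turnstile> And p q"
| OrL: "insert p (insert (Or p q) \<Gamma>) \<turnstile> r \<Longrightarrow> insert q (insert (Or p q) \<Gamma>) \<turnstile> r \<Longrightarrow>
    insert (Or p q) \<Gamma> \<turnstile> r"
| OrR1: "\<Gamma> \<turnstile> p \<Longrightarrow> \<Gamma> \<turnstile> Or p q"
| OrR2: "\<Gamma> \<turnstile> q \<Longrightarrow> \<Gamma> \<turnstile> Or p q"
| Cut: "\<Gamma> \<turnstile> p \<Longrightarrow> insert p \<Gamma> \<turnstile> q \<Longrightarrow> \<Gamma> \<turnstile> q"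
| ImpL: "insert (Imp p q) \<Gamma> \<turnstile> p \<Longrightarrow> insert q (insert (Imp p q) \<Gamma>) \<turnstile> r \<Longrightarrow>
    insert (Imp p q) \<Gamma> \<turnstile> r"
| ImpR: "insert p \<Gamma> \<turnstile> q \<Longrightarrow> \<Gamma> \<turnstile> Imp p q"
| NegL: "insert (Neg p) \<Gamma> \<turnstile> p \<Longrightarrow> insert (Neg p) \<Gamma> \<turnstile> r"
| NegR: "insert p \<Gamma> \<turnstile> Bot \<Longrightarrow> \<Gamma> \<turnstile> Neg p"
| BotL: "insert Bot \<Gamma> \<turnstile> p"
| TopR: "\<Gamma> \<turnstile> Top"
| WeakR: "\<Gamma> \<turnstile> Bot \<Longrightarrow> \<Gamma> \<turnstile> p"
| Zero: "\<Gamma> \<turnstile> q \<Longrightarrow> \<Gamma> \<turnstile> CImp p q"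
| Fix: "insert r (insert (CImp p q) \<Gamma>) \<turnstile> p \<Longrightarrow> insert q (insert (CImp p q) \<Gamma>) \<turnstile> r \<Longrightarrow>
    insert (CImp p q) \<Gamma> \<turnstile> r"
| PrePost: "insert p' (insert (CImp p q) \<Gamma>) \<turnstile> p \<Longrightarrow> insert q (insert (CImp p q) \<Gamma>) \<turnstile> q' \<Longrightarrow>
    insert (CImp p q) \<Gamma> \<turnstile> CImp p' q'"

fun big_and :: "'a form list \<Rightarrow> 'a form" where
  "big_and [] = Top"
| "big_and [p] = p"
| "big_and (p # q # ps) = And p (big_and (q # ps))"

section \<open>The fragment H-PCL\<close>

text \<open>
  The atoms \<open>a\<^sub>j\<close>, \<open>j \<in> J\<close>, form a list whose index set
  \<open>{..<length as}\<close> plays the role of \<open>J\<close>; likewise a formula is the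
  list of its clauses.
\<close>

datatype 'a clause =
    Facts "'a list"
  | Impl "'a list" 'a
  | CImpl "'a list" 'a

type_synonym 'a hpcl = "'a clause list"

fun clause_ok :: "'a clause \<Rightarrow> bool" where
  "clause_ok (Facts as) \<longleftrightarrow> length as \<ge> 1 \<and> distinct as"
| "clause_ok (Impl as b) \<longleftrightarrow> length as \<ge> 1 \<and> distinct as \<and> b \<notin> set as"
| "clause_ok (CImpl as b) \<longleftrightarrow> length as \<ge> 1 \<and> distinct as \<and> b \<notin> set as"

definition is_hpcl :: "'a hpcl \<Rightarrow> bool" where
  "is_hpcl p \<longleftrightarrow> length p \<ge> 2 \<and> (\<forall>c \<in> set p. clause_ok c)"

fun clause_form :: "'a clause \<Rightarrow> 'a form" where
  "clause_form (Facts as) = big_and (map Atom as)"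
| "clause_form (Impl as b) = Imp (big_and (map Atom as)) (Atom b)"
| "clause_form (CImpl as b) = CImp (big_and (map Atom as)) (Atom b)"

definition hpcl_form :: "'a hpcl \<Rightarrow> 'a form" where
  "hpcl_form p = big_and (map clause_form p)"

fun clause_atoms :: "'a clause \<Rightarrow> 'a list" where
  "clause_atoms (Facts as) = as"
| "clause_atoms (Impl as b) = as @ [b]"
| "clause_atoms (CImpl as b) = as @ [b]"

definition lambda_form :: "'a hpcl \<Rightarrow> 'a form" where
  "lambda_form p = big_and (map Atom (remdups (concat (map clause_atoms p))))"

section \<open>Translation of H-PCL into contract automata\<close>

text \<open>
  In a state, \<open>None\<close> is the extra element \<open>\<ast>\<close> and
  \<open>Some j\<close> is the index \<open>j\<close>.
\<close>

type_synonym pstate = "nat option set"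

definition star :: pstate where
  "star = {None}"

definition idx_state :: "nat set \<Rightarrow> pstate" where
  "idx_state q = insert None (Some ` q)"

definition pstates :: "'a list \<Rightarrow> pstate set" where
  "pstates as = idx_state ` Pow {..<length as}"

definition request_trans :: "'a list \<Rightarrow> (pstate list \<times> 'a label \<times> pstate list) set" where
  "request_trans as =
     {([insert (Some j) J'], [Req (as ! j)], [J']) | j J'.
        j < length as \<and> J' \<in> pstates as \<and> Some j \<notin> J'}"

fun clause_ca :: "'a clause \<Rightarrow> (pstate, 'a) ca" where
  "clause_ca (Facts as) =
    \<lparr> ca_rank = 1,
      ca_states = {[star]},
      ca_init = [star],
      ca_requests = {},
      ca_offers = Off ` set as,
      ca_trans = {([star], [Off (as ! j)], [star]) | j. j < length as},
      ca_final = {[star]} \<rparr>"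
| "clause_ca (Impl as b) =
    \<lparr> ca_rank = 1,
      ca_states = {[q] | q. q \<in> pstates as},
      ca_init = [idx_state {..<length as}],
      ca_requests = Req ` set as,
      ca_offers = {Off b},
      ca_trans = request_trans as \<union> {([star], [Off b], [star])},
      ca_final = {[star]} \<rparr>"
| "clause_ca (CImpl as b) =
    \<lparr> ca_rank = 1,
      ca_states = {[q] | q. q \<in> pstates as},
      ca_init = [idx_state {..<length as}],
      ca_requests = Req ` set as,
      ca_offers = {Off b},
      ca_trans = request_trans as \<union> {([q], [Off b], [q]) | q. q \<in> pstates as},
      ca_final = {[star]} \<rparr>"

definition hpcl_ca :: "'a hpcl \<Rightarrow> (pstate, 'a) ca" where
  "hpcl_ca p = ca_aproduct (map clause_ca p)"

section \<open>The translation yields contract automata\<close>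

lemma pstates_star [simp]: "star \<in> pstates as"
  by (auto simp: pstates_def star_def idx_state_def intro!: image_eqI[where x="{}"])

lemma pstates_full [simp]: "idx_state {..<length as} \<in> pstates as"
  by (auto simp: pstates_def)

lemma pstates_insert: "j < length as \<Longrightarrow> q \<in> pstates as \<Longrightarrow> insert (Some j) q \<in> pstates as"
proof -
  assume "j < length as" "q \<in> pstates as"
  then obtain J where "J \<subseteq> {..<length as}" "q = idx_state J" by (auto simp: pstates_def)
  with \<open>j < length as\<close> show ?thesis
    by (auto simp: pstates_def idx_state_def intro!: image_eqI[where x="insert j J"])
qed

lemma request_single [simp]: "is_request [Req a]"
  unfolding is_request_def request_on_def requests_def
  by (intro exI[of _ "Req a"] conjI exI[of _ 0]) auto

lemma offer_single [simp]: "is_offer [Off a]"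
  unfolding is_offer_def offer_on_def offers_def
  by (intro exI[of _ "Off a"] conjI exI[of _ 0]) auto

lemma listset_singleton: "listset [Q] = {[q] | q. q \<in> Q}"
  by (auto simp: set_Cons_def)

lemma is_ca_clause_ca: "is_ca (clause_ca c)"
proof (cases c)
  case (Facts as)
  have "\<exists>Qs. length Qs = 1 \<and> (\<forall>Q \<in> set Qs. finite Q) \<and> {[star]} = listset Qs"
    by (intro exI[of _ "[{star}]"]) (simp add: listset_singleton del: listset.simps)
  then show ?thesis using Facts
    by (auto simp: is_ca_def requests_def offers_def)
next
  case (Impl as b)
  have "\<exists>Qs. length Qs = 1 \<and> (\<forall>Q \<in> set Qs. finite Q) \<and> {[q] | q. q \<in> pstates as} = listset Qs"
    by (intro exI[of _ "[pstates as]"]) (simp add: listset_singleton pstates_def del: listset.simps)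
  then show ?thesis using Impl
    by (auto simp: is_ca_def requests_def offers_def request_trans_def pstates_insert)
next
  case (CImpl as b)
  have "\<exists>Qs. length Qs = 1 \<and> (\<forall>Q \<in> set Qs. finite Q) \<and> {[q] | q. q \<in> pstates as} = listset Qs"
    by (intro exI[of _ "[pstates as]"]) (simp add: listset_singleton pstates_def del: listset.simps)
  then show ?thesis using CImpl
    by (auto simp: is_ca_def requests_def offers_def request_trans_def pstates_insert)
qed

lemma ca_projection_0:
  assumes "is_ca A" "ca_rank A = 1"
    "\<And>a. a \<in> ca_requests A \<union> ca_offers A \<Longrightarrow> \<exists>q q'. (q, [a], q') \<in> ca_trans A"
  shows "ca_projection 0 A = A"
proof -
  have len: "q \<in> ca_states A \<Longrightarrow> [q ! 0] = q" for q
    using assms(1,2) by (auto simp: is_ca_def length_Suc_conv set_Cons_def)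
  have tr: "[q ! 0] = q \<and> [v ! 0] = v \<and> [q' ! 0] = q' \<and> v ! 0 \<noteq> Idle" if "(q, v, q') \<in> ca_trans A" for q v q'
  proof -
    have l: "length v = 1" and "q \<in> ca_states A" "q' \<in> ca_states A"
      and k: "is_request v \<or> is_offer v \<or> is_match v"
      using assms(1,2) that unfolding is_ca_def by fastforce+
    moreover from l obtain a where v: "v = [a]" by (auto simp: length_Suc_conv)
    moreover have "a \<noteq> Idle" using k unfolding v
      by (auto simp: is_request_def is_offer_def is_match_def request_on_def offer_on_def match_on_def
        requests_def offers_def Cons_eq_append_conv)
    ultimately show ?thesis using len by auto
  qed
  have r: "{a \<in> X. \<exists>(q, v, q') \<in> ca_trans A. v ! 0 = a} = X" if X: "X \<subseteq> ca_requests A \<union> ca_offers A" for X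
  proof (intro set_eqI iffI)
    fix a assume a: "a \<in> X"
    then obtain q q' where "(q, [a], q') \<in> ca_trans A" using assms(3) X by blast
    with a show "a \<in> {a \<in> X. \<exists>(q, v, q') \<in> ca_trans A. v ! 0 = a}"
      by (intro CollectI conjI) (auto intro!: bexI[of _ "(q, [a], q')"])
  qed auto
  have img: "(\<lambda>q. [q ! 0]) ` X = X" if "X \<subseteq> ca_states A" for X
  proof -
    have "(\<lambda>q. [q ! 0]) ` X = (\<lambda>q. q) ` X" by (rule image_cong[OF refl]) (rule len, rule subsetD[OF that])
    then show ?thesis by simp
  qed
  have sub: "ca_final A \<subseteq> ca_states A" and "ca_init A \<in> ca_states A" using assms(1) unfolding is_ca_def by blast+
  then have "[ca_init A ! 0] = ca_init A" by (intro len)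
  moreover note img[OF subset_refl] img[OF sub]
  moreover have "{([q ! 0], [v ! 0], [q' ! 0]) | q v q'. (q, v, q') \<in> ca_trans A \<and> v ! 0 \<noteq> Idle} = ca_trans A"
    (is "?L = _")
  proof (intro set_eqI iffI; clarify)
    fix q v q' assume "(q, v, q') \<in> ca_trans A"
    then show "([q ! 0], [v ! 0], [q' ! 0]) \<in> ca_trans A" using tr by metis
  next
    fix q v q' assume "(q, v, q') \<in> ca_trans A"
    then show "\<exists>p w p'. (q, v, q') = ([p ! 0], [w ! 0], [p' ! 0]) \<and> (p, w, p') \<in> ca_trans A \<and> w ! 0 \<noteq> Idle"
      using tr by metis
  qed
  ultimately show ?thesis
    using r[of "ca_requests A"] r[of "ca_offers A"] assms(2)
    unfolding ca_projection_def by (cases A) simp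
qed

lemma request_trans_used:
  "a \<in> set as \<Longrightarrow> \<exists>q q'. (q, [Req a], q') \<in> request_trans as"
proof -
  assume "a \<in> set as"
  then obtain j where j: "j < length as" "as ! j = a" by (auto simp: in_set_conv_nth)
  then have "([insert (Some j) star], [Req (as ! j)], [star]) \<in> request_trans as"
    unfolding request_trans_def
    by (intro CollectI exI[of _ j] exI[of _ star]) (simp, simp add: star_def)
  with j show ?thesis by blast
qed

lemma ca_projection_clause_ca: "ca_projection 0 (clause_ca c) = clause_ca c"
proof (rule ca_projection_0[OF is_ca_clause_ca])
  show "ca_rank (clause_ca c) = 1" by (cases c) auto
  show "\<exists>q q'. (q, [a], q') \<in> ca_trans (clause_ca c)"
    if "a \<in> ca_requests (clause_ca c) \<union> ca_offers (clause_ca c)" for a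
  proof (cases c)
    case (Facts as)
    with that show ?thesis by (auto simp: in_set_conv_nth)
  next
    case (Impl as b)
    with that show ?thesis using request_trans_used by fastforce
  next
    case (CImpl as b)
    with that show ?thesis 
    proof (cases "a = Off b")
      case True
      have "([star], [a], [star]) \<in> ca_trans (clause_ca c)"
        using CImpl True pstates_star[of as] by simp
      then show ?thesis by blast
    next
      case False
      with that CImpl obtain d where "a = Req d" "d \<in> set as" by auto
      then show ?thesis using CImpl request_trans_used[of d as] by auto
    qed
  qed
qed

lemma hpcl_ca_eq: "hpcl_ca p = ca_product (map clause_ca p)"
proof -
  have "[0..<ca_rank (clause_ca c)] = [0]" for c :: "'a clause" by (cases c) auto
  then have "concat (map (\<lambda>A. map (\<lambda>i. ca_projection i A) [0..<ca_rank A]) (map clause_ca p)) = map clause_ca p"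
    by (induction p) (auto simp: ca_projection_clause_ca)
  then show ?thesis by (simp add: hpcl_ca_def ca_aproduct_def)
qed

lemma listset_iff: "qs \<in> listset Qs \<longleftrightarrow> list_all2 (\<in>) qs Qs"
  by (induction Qs arbitrary: qs) (auto simp: set_Cons_def list_all2_Cons2)

lemma concat_listset: "concat ` listset (map listset Qss) = listset (concat Qss)"
proof -
  have "xs \<in> concat ` listset (map listset Qss) \<longleftrightarrow> xs \<in> listset (concat Qss)" for xs
  proof (induction Qss arbitrary: xs)
    case (Cons Qs Qss)
    have "xs \<in> concat ` listset (map listset (Qs # Qss)) \<longleftrightarrow>
      (\<exists>y ys. xs = y @ ys \<and> y \<in> listset Qs \<and> ys \<in> concat ` listset (map listset Qss))"
    proof safe
      fix qs assume "qs \<in> listset (map listset (Qs # Qss))"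
      then obtain y zs where "qs = y # zs" "y \<in> listset Qs" "zs \<in> listset (map listset Qss)"
        by (auto simp: set_Cons_def)
      then show "\<exists>y ys. concat qs = y @ ys \<and> y \<in> listset Qs \<and> ys \<in> concat ` listset (map listset Qss)"
        by (intro exI[of _ y] exI[of _ "concat zs"]) simp
    next
      fix y zs assume "y \<in> listset Qs" "zs \<in> listset (map listset Qss)"
      then show "y @ concat zs \<in> concat ` listset (map listset (Qs # Qss))"
        by (intro image_eqI[of _ _ "y # zs"]) (simp_all add: set_Cons_def)
    qed
    also have "\<dots> \<longleftrightarrow> xs \<in> listset (concat (Qs # Qss))"
      unfolding Cons.IH listset_iff concat.simps list_all2_append2 by (blast dest: list_all2_lengthD)
    finally show ?case .
  qed auto
  then show ?thesis by blast
qed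

lemma is_ca_product:
  assumes ca: "\<And>A. A \<in> set As \<Longrightarrow> is_ca A"
  shows "is_ca (ca_product As)"
proof -
  let ?P = "ca_product As" and ?n = "length As"
  have "\<forall>A \<in> set As. \<exists>Qs. length Qs = ca_rank A \<and> (\<forall>Q \<in> set Qs. finite Q) \<and> ca_states A = listset Qs"
    using ca unfolding is_ca_def by blast
  then obtain Qf where Qf: "\<And>A. A \<in> set As \<Longrightarrow> length (Qf A) = ca_rank A \<and> (\<forall>Q \<in> set (Qf A). finite Q) \<and> ca_states A = listset (Qf A)"
    by metis
  have "map ca_states As = map listset (map Qf As)" using Qf by simp
  then have st: "ca_states ?P = listset (concat (map Qf As))"
    by (simp only: ca_product_def ca.simps concat_listset)
  have "length (concat (map Qf As)) = ca_rank ?P"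
    using Qf by (auto simp: ca_product_def length_concat intro!: arg_cong[of _ _ sum_list])
  then have states: "\<exists>Qs. length Qs = ca_rank ?P \<and> (\<forall>Q \<in> set Qs. finite Q) \<and> ca_states ?P = listset Qs"
    using st Qf by (intro exI[of _ "concat (map Qf As)"]) auto
  have init: "ca_init ?P \<in> ca_states ?P"
    using ca by (auto simp: ca_product_def listset_iff list_all2_conv_all_nth is_ca_def intro!: imageI)
  have "ca_final A \<subseteq> ca_states A" if "A \<in> set As" for A using ca[OF that] unfolding is_ca_def by blast
  then have "listset (map ca_final As) \<subseteq> listset (map ca_states As)"
    by (auto simp: listset_iff list_all2_conv_all_nth subset_iff)
  then have final: "ca_final ?P \<subseteq> ca_states ?P" by (auto simp: ca_product_def)
  have "finite (ca_requests A) \<and> ca_requests A \<subseteq> requests \<and> finite (ca_offers A) \<and> ca_offers A \<subseteq> offers"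
    if "A \<in> set As" for A using ca[OF that] unfolding is_ca_def by blast
  then have alph: "finite (ca_requests ?P)" "ca_requests ?P \<subseteq> requests" "finite (ca_offers ?P)" "ca_offers ?P \<subseteq> offers"
    by (fastforce simp: ca_product_def)+
  define S where "S q v q' \<longleftrightarrow> length q = length v \<and> length q' = length v \<and> set v \<subseteq> ca_requests ?P \<union> ca_offers ?P \<union> {Idle}
    \<and> (\<forall>i < length v. v ! i = Idle \<longrightarrow> q' ! i = q ! i)" for q :: "'a list" and v :: "'b label" and q' :: "'a list"
  have S_app: "S (q @ p) (v @ w) (q' @ p')" if "S q v q'" "S p w p'" for q v q' p w p'
    using that unfolding S_def by (auto simp: nth_append)
  have S_idle: "S q (replicate (length q) Idle) q" for q unfolding S_def by auto
  have S_tr: "S q v q'" if "(q, v, q') \<in> ca_trans A" "A \<in> set As" for q v q' A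
  proof -
    have len: "q \<in> ca_states A \<Longrightarrow> length q = ca_rank A" for q
      using Qf[OF that(2)] by (auto simp: listset_iff dest: list_all2_lengthD)
    have "q \<in> ca_states A" "q' \<in> ca_states A" "length v = ca_rank A" "set v \<subseteq> ca_requests A \<union> ca_offers A \<union> {Idle}"
      "\<forall>i < ca_rank A. v ! i = Idle \<longrightarrow> q' ! i = q ! i"
      using ca[OF that(2)] that(1) unfolding is_ca_def by fastforce+
    moreover have "ca_requests A \<subseteq> ca_requests ?P" "ca_offers A \<subseteq> ca_offers ?P"
      using that(2) by (auto simp: ca_product_def)
    ultimately show ?thesis using len unfolding S_def by auto
  qed
  have seg: "length (concat (map ((!) qs) [a..<b])) = (\<Sum>k=a..<b. ca_rank (As ! k))"
    if "qs \<in> listset (map ca_states As)" "b \<le> ?n" for qs a b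
  proof -
    have "length (qs ! k) = ca_rank (As ! k)" if "k < ?n" for k
      using Qf[of "As ! k"] that \<open>qs \<in> _\<close> by (auto simp: listset_iff list_all2_conv_all_nth)
    then have "map length (map ((!) qs) [a..<b]) = map (\<lambda>k. ca_rank (As ! k)) [a..<b]" using that(2) by auto
    then show ?thesis by (simp only: length_concat interv_sum_list_conv_sum_set_nat set_upt)
  qed
  have pad: "is_request (replicate m Idle @ v @ replicate k Idle)" if v: "is_request v" for v :: "'b label" and m k
  proof -
    obtain \<alpha> n1 n2 where "\<alpha> \<in> requests" "v = replicate n1 Idle @ [\<alpha>] @ replicate n2 Idle"
      using v by (auto simp: is_request_def request_on_def)
    then have "request_on \<alpha> (replicate m Idle @ v @ replicate k Idle)"
      unfolding request_on_def by (intro conjI exI[of _ "m + n1"] exI[of _ "n2 + k"]) (auto simp: replicate_add)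
    then show ?thesis unfolding is_request_def by blast
  qed
  have pad': "is_offer (replicate m Idle @ v @ replicate k Idle)" if v: "is_offer v" for v :: "'b label" and m k
  proof -
    obtain \<alpha> n1 n2 where "\<alpha> \<in> offers" "v = replicate n1 Idle @ [\<alpha>] @ replicate n2 Idle"
      using v by (auto simp: is_offer_def offer_on_def)
    then have "offer_on \<alpha> (replicate m Idle @ v @ replicate k Idle)"
      unfolding offer_on_def by (intro conjI exI[of _ "m + n1"] exI[of _ "n2 + k"]) (auto simp: replicate_add)
    then show ?thesis unfolding is_offer_def by blast
  qed
  have pad'': "is_match (replicate m Idle @ v @ replicate k Idle)" if v: "is_match v" for v :: "'b label" and m k
  proof -
    obtain \<alpha> n1 n2 n3 where "\<alpha> \<in> requests \<union> offers" "v = replicate n1 Idle @ [\<alpha>] @ replicate n2 Idle @ [co \<alpha>] @ replicate n3 Idle"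
      using v by (auto simp: is_match_def match_on_def)
    then have "match_on \<alpha> (replicate m Idle @ v @ replicate k Idle)"
      unfolding match_on_def by (intro conjI exI[of _ "m + n1"] exI[of _ n2] exI[of _ "n3 + k"]) (auto simp: replicate_add)
    then show ?thesis unfolding is_match_def by blast
  qed
  have mat: "is_match (replicate m Idle @ v @ replicate k Idle @ w @ replicate l Idle)" if vw: "v \<bowtie> w"
    for v w :: "'b label" and m k l
  proof -
    obtain \<alpha> n1 n2 n3 n4 where "\<alpha> \<in> requests \<union> offers"
      "v = replicate n1 Idle @ [\<alpha>] @ replicate n2 Idle" "w = replicate n3 Idle @ [co \<alpha>] @ replicate n4 Idle"
      using vw unfolding complementary_def request_on_def offer_on_def by blast
    then have "match_on \<alpha> (replicate m Idle @ v @ replicate k Idle @ w @ replicate l Idle)"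
      unfolding match_on_def by (intro conjI exI[of _ "m + n1"] exI[of _ "n2 + k + n3"] exI[of _ "n4 + l"]) (auto simp: replicate_add)
    then show ?thesis unfolding is_match_def by blast
  qed
  have split1: "concat (qs[i := q]) = concat (map ((!) qs) [0..<i]) @ q @ concat (map ((!) qs) [Suc i..<?n])"
    if "length qs = ?n" "i < ?n" for qs :: "'a list list" and i q
  proof -
    have "qs[i := q] = map ((!) (qs[i := q])) [0..<?n]" using that by (metis length_list_update map_nth)
    also have "[0..<?n] = [0..<i] @ [i] @ [Suc i..<?n]" using that by (metis append_Cons append_Nil le0 less_imp_le upt_add_eq_append upt_conv_Cons le_add_diff_inverse)
    also have "map ((!) (qs[i := q])) \<dots> = map ((!) qs) [0..<i] @ [q] @ map ((!) qs) [Suc i..<?n]"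
      using that by auto
    finally show ?thesis by simp
  qed
  have split2: "concat (qs[i := q, j := q']) = concat (map ((!) qs) [0..<i]) @ q @ concat (map ((!) qs) [Suc i..<j]) @ q' @ concat (map ((!) qs) [Suc j..<?n])"
    if "length qs = ?n" "i < j" "j < ?n" for qs :: "'a list list" and i j q q'
  proof -
    have u: "[0..<j] = [0..<i] @ [i] @ [Suc i..<j]" using that by (metis append_Cons append_Nil le0 less_imp_le upt_add_eq_append upt_conv_Cons le_add_diff_inverse)
    have "concat (map ((!) (qs[i := q])) [0..<j]) = concat (map ((!) qs) [0..<i]) @ q @ concat (map ((!) qs) [Suc i..<j])"
    proof -
      have "map ((!) (qs[i := q])) [0..<i] = map ((!) qs) [0..<i]"
        "map ((!) (qs[i := q])) [Suc i..<j] = map ((!) qs) [Suc i..<j]" using that by auto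
      then show ?thesis using that unfolding u by (simp del: map_eq_conv)
    qed
    moreover have "map ((!) (qs[i := q])) [Suc j..<?n] = map ((!) qs) [Suc j..<?n]" using that by auto
    ultimately show ?thesis using split1[of "qs[i := q]" j q'] that by (simp del: map_eq_conv)
  qed
  have nS: "length q = ca_rank ?P" if "q \<in> ca_states ?P" for q
    using that states by (metis listset_iff list_all2_lengthD)
  have upd: "qs[i := q] \<in> listset (map ca_states As)" if "qs \<in> listset (map ca_states As)" "i < ?n" "q \<in> ca_states (As ! i)" for qs i q
    using that by (auto simp: listset_iff list_all2_conv_all_nth nth_list_update)
  have tgt: "q' \<in> ca_states A" if "(q, v, q') \<in> ca_trans A" "A \<in> set As" for q v q' A
    using ca[OF that(2)] that(1) unfolding is_ca_def by fastforce
  have cst: "concat qs \<in> ca_states ?P" if "qs \<in> listset (map ca_states As)" for qs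
    using that by (simp add: ca_product_def)
  have "q \<in> ca_states ?P \<and> q' \<in> ca_states ?P \<and> S q v q' \<and> (is_request v \<or> is_offer v \<or> is_match v)"
    if "(q, v, q') \<in> ca_trans ?P" for q v q'
  proof -
    from that consider
      (two) qs i j a b p p' where "q = concat qs" "q' = concat (qs[i := p, j := p'])"
        "v = replicate (\<Sum>k<i. ca_rank (As ! k)) Idle @ a @ replicate (\<Sum>k=Suc i..<j. ca_rank (As ! k)) Idle @ b @
          replicate (\<Sum>k=Suc j..<length As. ca_rank (As ! k)) Idle"
        "qs \<in> listset (map ca_states As)" "i < j" "j < ?n" "(qs ! i, a, p) \<in> ca_trans (As ! i)" "(qs ! j, b, p') \<in> ca_trans (As ! j)" "a \<bowtie> b"
    | (one) qs i a p where "q = concat qs" "q' = concat (qs[i := p])"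
        "v = replicate (\<Sum>k<i. ca_rank (As ! k)) Idle @ a @ replicate (\<Sum>k=Suc i..<length As. ca_rank (As ! k)) Idle"
        "qs \<in> listset (map ca_states As)" "i < ?n" "(qs ! i, a, p) \<in> ca_trans (As ! i)"
      by (auto simp: ca_product_def)
    then show ?thesis
    proof cases
      case two
      have l: "length qs = ?n" using two(4) by (auto simp: listset_iff dest: list_all2_lengthD)
      have e: "q = concat (qs[i := qs ! i, j := qs ! j])" using two by simp
      have t: "S (qs ! i) a p" "S (qs ! j) b p'" using S_tr two(5-8) by simp_all
      have "S q v q'" unfolding e two(2) split2[OF l two(5,6)] two(3) lessThan_atLeast0
        seg[OF two(4) less_imp_le[OF less_trans[OF two(5,6)]], symmetric]
        seg[OF two(4) less_imp_le[OF two(6)], symmetric] seg[OF two(4) le_refl, symmetric]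
        by (intro S_app S_idle t)
      moreover have "q' \<in> ca_states ?P" using two by (auto intro!: cst upd tgt)
      ultimately show ?thesis using two cst mat by auto
    next
      case one
      have l: "length qs = ?n" using one(4) by (auto simp: listset_iff dest: list_all2_lengthD)
      have e: "q = concat (qs[i := qs ! i])" using one by simp
      have t: "S (qs ! i) a p" using S_tr one(5,6) by simp
      have "S q v q'" unfolding e one(2) split1[OF l one(5)] one(3) lessThan_atLeast0
        seg[OF one(4) less_imp_le[OF one(5)], symmetric] seg[OF one(4) le_refl, symmetric]
        by (intro S_app S_idle t)
      moreover have "q' \<in> ca_states ?P" using one by (auto intro!: cst upd tgt)
      moreover have "is_request a \<or> is_offer a \<or> is_match a"
        using ca[of "As ! i"] one(5,6) unfolding is_ca_def by fastforce
      ultimately show ?thesis using one cst pad pad' pad'' by auto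
    qed
  qed
  then show ?thesis
    using states init final alph nS unfolding is_ca_def S_def
    by (intro conjI ballI; (assumption | clarsimp))
qed

lemma is_ca_hpcl_ca: "is_ca (hpcl_ca p)"
  unfolding hpcl_ca_eq by (rule is_ca_product) (auto simp: is_ca_clause_ca)

lemma ca_rank_hpcl_ca: "ca_rank (hpcl_ca p) = length p"
proof -
  have "ca_rank (clause_ca c) = 1" for c :: "'a clause" by (cases c) auto
  then show ?thesis by (simp add: hpcl_ca_eq ca_product_def comp_def sum_list_triv)
qed

end

theory Submission
  imports Defs
begin

text \<open>
  Both sides are equivalent to a third condition.  Let \<open>avail p\<close> be the least set of
  atoms that contains the facts and the conclusions of all contractual implications and is closed
  under the ordinary implications; the condition is that every atom of \<open>p\<close> is in it.

  In the logic, reading \<open>CImp p q\<close> as \<open>q\<close> makes every rule classically sound,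
  and \<open>avail p\<close> is then a model of \<open>p\<close>.  Conversely \<open>Fix\<close>, applied
  with \<open>lambda_form p\<close> as right-hand side, has a trivial first premise and releases the
  conclusion of each contractual implication.

  In the automaton, along a run without unmatched requests only available atoms are ever offered.
  Conversely, a state with pending requests none of which can be matched offers all available
  atoms; so if all atoms are available, there is no such state, and matches lead to the final state.
\<close>

section \<open>Available atoms\<close>

text \<open>Empty for \<open>Facts\<close>, so that its only state \<open>star\<close> is
  \<open>idx_state {}\<close> and the local states of every clause are
  \<open>pstates (antecedents c)\<close>. A state holds the indices of the antecedents still to be
  requested.\<close>

fun antecedents :: "'a clause \<Rightarrow> 'a list" where
  "antecedents (Facts as) = []"
| "antecedents (Impl as b) = as"
| "antecedents (CImpl as b) = as"

inductive_set avail :: "'a hpcl \<Rightarrow> 'a set" for p where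
  facts: "Facts as \<in> set p \<Longrightarrow> a \<in> set as \<Longrightarrow> a \<in> avail p"
| cimpl: "CImpl as b \<in> set p \<Longrightarrow> b \<in> avail p"
| impl: "Impl as b \<in> set p \<Longrightarrow> (\<And>a. a \<in> set as \<Longrightarrow> a \<in> avail p) \<Longrightarrow> b \<in> avail p"

definition all_avail :: "'a hpcl \<Rightarrow> bool" where
  "all_avail p \<longleftrightarrow> (\<forall>c \<in> set p. set (clause_atoms c) \<subseteq> avail p)"

text \<open>Facts and contractual conclusions are available outright, and an ordinary conclusion is
  available as soon as its antecedents are. Only the antecedents, which are what the automaton
  requests, remain to be checked.\<close>

lemma all_avail_iff: "all_avail p \<longleftrightarrow> (\<forall>c \<in> set p. set (antecedents c) \<subseteq> avail p)"
proof -
  have "set (clause_atoms c) \<subseteq> avail p \<longleftrightarrow> set (antecedents c) \<subseteq> avail p" if "c \<in> set p" for c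
    by (cases c) (use that in \<open>auto intro: avail.intros\<close>)
  then show ?thesis by (simp add: all_avail_def)
qed

section \<open>Provability\<close>

fun sat :: "'a set \<Rightarrow> 'a form \<Rightarrow> bool" where
  "sat V (Atom a) \<longleftrightarrow> a \<in> V"
| "sat V Bot \<longleftrightarrow> False"
| "sat V Top \<longleftrightarrow> True"
| "sat V (Neg p) \<longleftrightarrow> \<not> sat V p"
| "sat V (Or p q) \<longleftrightarrow> sat V p \<or> sat V q"
| "sat V (And p q) \<longleftrightarrow> sat V p \<and> sat V q"
| "sat V (Imp p q) \<longleftrightarrow> (sat V p \<longrightarrow> sat V q)"
| "sat V (CImp p q) \<longleftrightarrow> sat V q"

text \<open>For \<open>Fix\<close> and \<open>PrePost\<close> the second premise alone carries the
  argument: a true \<open>CImp p q\<close> on the left makes \<open>q\<close> true.\<close>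

lemma pcl_sound: "\<Gamma> \<turnstile> p \<Longrightarrow> \<forall>q \<in> \<Gamma>. sat V q \<Longrightarrow> sat V p"
  by (induction rule: pcl.induct) auto

lemma sat_big_and: "sat V (big_and ps) \<longleftrightarrow> (\<forall>p \<in> set ps. sat V p)"
  by (induction ps rule: big_and.induct) auto

lemma all_avail_if_provable:
  assumes "{hpcl_form p} \<turnstile> lambda_form p"
  shows "all_avail p"
proof -
  have "sat (avail p) (clause_form c)" if "c \<in> set p" for c
    by (cases c) (use that in \<open>auto simp: sat_big_and intro: avail.intros\<close>)
  then have "sat (avail p) (hpcl_form p)" by (simp add: hpcl_form_def sat_big_and)
  with pcl_sound[OF assms, of "avail p"] show ?thesis
    by (auto simp: lambda_form_def sat_big_and all_avail_def)
qed

section \<open>Derivations in the calculus\<close>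

lemma pcl_id: "p \<in> \<Gamma> \<Longrightarrow> \<Gamma> \<turnstile> p"
  by (metis insert_absorb pcl.Id)

lemma pcl_big_and_elim: "big_and ps \<in> \<Gamma> \<Longrightarrow> p \<in> set ps \<Longrightarrow> \<Gamma> \<turnstile> p"
proof (induction ps arbitrary: \<Gamma> rule: big_and.induct)
  case (3 q q' ps)
  let ?A = "And q (big_and (q' # ps))"
  \<comment> \<open>The left rules require a context of the form \<open>insert (And _ _) _\<close>;
    since the conjunction already lies in \<Gamma>, that context is \<Gamma> itself.\<close>
  have ins: "insert ?A \<Gamma> = \<Gamma>" using 3 by auto
  show ?case
  proof (cases "p = q")
    case True
    then show ?thesis using pcl.AndL1[of q "big_and (q' # ps)" \<Gamma> p] ins by (simp add: pcl.Id)
  next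
    case False
    then have "insert (big_and (q' # ps)) \<Gamma> \<turnstile> p" using 3 by auto
    then show ?thesis using pcl.AndL2[of "big_and (q' # ps)" q \<Gamma> p] ins by simp
  qed
qed (auto intro: pcl_id)

lemma pcl_big_and_intro: "(\<And>p. p \<in> set ps \<Longrightarrow> \<Gamma> \<turnstile> p) \<Longrightarrow> \<Gamma> \<turnstile> big_and ps"
  by (induction ps rule: big_and.induct) (auto intro: pcl.TopR pcl.AndR)

lemma pcl_clause: "hpcl_form p \<in> \<Gamma> \<Longrightarrow> c \<in> set p \<Longrightarrow> \<Gamma> \<turnstile> clause_form c"
  unfolding hpcl_form_def by (rule pcl_big_and_elim) auto

definition cimpl_heads :: "'a hpcl \<Rightarrow> 'a set" where
  "cimpl_heads p = {b. \<exists>as. CImpl as b \<in> set p}"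

lemma finite_cimpl_heads: "finite (cimpl_heads p)"
proof (rule finite_subset)
  show "cimpl_heads p \<subseteq> (\<Union>c \<in> set p. set (clause_atoms c))"
    by (force simp: cimpl_heads_def)
qed simp

text \<open>With the heads of the contractual implications assumed on the left, only facts and
  ordinary implications have to be used, so the derivation follows the generation of
  \<open>avail p\<close>. The context stays arbitrary because \<open>ImpL\<close> enlarges
  it.\<close>

lemma pcl_avail:
  "a \<in> avail p \<Longrightarrow> hpcl_form p \<in> \<Gamma> \<Longrightarrow> Atom ` cimpl_heads p \<subseteq> \<Gamma> \<Longrightarrow> \<Gamma> \<turnstile> Atom a"
proof (induction arbitrary: \<Gamma> rule: avail.induct)
  case (facts as a)
  have c: "\<Gamma> \<turnstile> big_and (map Atom as)" using pcl_clause[OF facts(3,1)] by simp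
  show ?case by (rule pcl.Cut[OF c]) (rule pcl_big_and_elim[of "map Atom as"], use facts in auto)
next
  case (cimpl as b)
  then show ?case by (intro pcl_id) (auto simp: cimpl_heads_def)
next
  case (impl as b)
  let ?P = "big_and (map Atom as)"
  have c: "\<Gamma> \<turnstile> Imp ?P (Atom b)" using pcl_clause[OF impl(4,1)] by simp
  have "insert (Imp ?P (Atom b)) \<Gamma> \<turnstile> ?P"
    by (rule pcl_big_and_intro) (use impl(4,5) in \<open>auto intro!: impl(3)\<close>)
  then have "insert (Imp ?P (Atom b)) \<Gamma> \<turnstile> Atom b" by (rule pcl.ImpL) (rule pcl.Id)
  with c show ?case by (rule pcl.Cut)
qed

lemma provable_if_all_avail:
  assumes "all_avail p"
  shows "{hpcl_form p} \<turnstile> lambda_form p"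
proof -
  \<comment> \<open>\<open>D\<close> is the set of heads not yet on the left. Each use of
    \<open>Fix\<close> moves one of them there, and the empty set is the case of
    \<open>pcl_avail\<close>.\<close>
  have "\<Gamma> \<turnstile> lambda_form p"
    if "finite D" "D \<subseteq> cimpl_heads p" "hpcl_form p \<in> \<Gamma>" "Atom ` (cimpl_heads p - D) \<subseteq> \<Gamma>" for D \<Gamma>
    using that
  proof (induction D arbitrary: \<Gamma> rule: finite_induct)
    case empty
    show ?case unfolding lambda_form_def
      by (rule pcl_big_and_intro) (use assms empty in \<open>auto simp: all_avail_def intro!: pcl_avail\<close>)
  next
    case (insert b D)
    then obtain as where as: "CImpl as b \<in> set p" by (auto simp: cimpl_heads_def)
    let ?P = "big_and (map Atom as)"
    let ?\<Delta> = "Set.insert (CImp ?P (Atom b)) \<Gamma>"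
    have c: "\<Gamma> \<turnstile> CImp ?P (Atom b)" using pcl_clause[OF insert(5) as] by simp
    \<comment> \<open>First premise of \<open>Fix\<close>: the antecedents of the clause are
      themselves conjuncts of the goal, which \<open>Fix\<close> allows to be assumed.\<close>
    have "Set.insert (lambda_form p) ?\<Delta> \<turnstile> Atom a" if "a \<in> set as" for a
    proof (rule pcl_big_and_elim)
      show "big_and (map Atom (remdups (concat (map clause_atoms p)))) \<in> Set.insert (lambda_form p) ?\<Delta>"
        by (simp add: lambda_form_def)
      show "Atom a \<in> set (map Atom (remdups (concat (map clause_atoms p))))"
        using as that by force
    qed
    then have P: "Set.insert (lambda_form p) ?\<Delta> \<turnstile> ?P" by (intro pcl_big_and_intro) auto
    have "Set.insert (Atom b) ?\<Delta> \<turnstile> lambda_form p" by (rule insert.IH) (use insert.prems in auto)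
    with P have "?\<Delta> \<turnstile> lambda_form p" by (rule pcl.Fix)
    with c show ?case by (rule pcl.Cut)
  qed
  from this[OF finite_cimpl_heads order_refl] show ?thesis by simp
qed

section \<open>Transitions of the product\<close>

lemma padded_eq_single [simp]:
  "[x] = replicate m Idle @ \<alpha> # replicate n Idle \<longleftrightarrow> m = 0 \<and> n = 0 \<and> x = \<alpha>"
  by (cases m; cases n) auto

lemma request_on_single [simp]: "request_on \<alpha> [x] \<longleftrightarrow> \<alpha> \<in> requests \<and> x = \<alpha>"
  by (auto simp: request_on_def)

lemma offer_on_single [simp]: "offer_on \<alpha> [x] \<longleftrightarrow> \<alpha> \<in> offers \<and> x = \<alpha>"
  by (auto simp: offer_on_def)

lemma complementary_single:
  "[x] \<bowtie> [y] \<longleftrightarrow> (\<exists>a. x = Req a \<and> y = Off a \<or> x = Off a \<and> y = Req a)"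
proof -
  have "[x] \<bowtie> [y] \<longleftrightarrow> (x \<in> requests \<and> co x \<in> offers \<or> x \<in> offers \<and> co x \<in> requests) \<and> y = co x"
    unfolding complementary_def request_on_single offer_on_single
    by (simp only: ex_disj_distrib) blast
  then show ?thesis
    by (cases x) (auto simp: requests_def offers_def)
qed

text \<open>Deleting the idle entries leaves one entry here, but two in a match, since
  \<open>co\<close> maps non-idle actions to non-idle ones.\<close>

lemma not_is_match_single:
  assumes "x \<noteq> Idle"
  shows "\<not> is_match (replicate m Idle @ [x] @ replicate n Idle)"
proof
  assume "is_match (replicate m Idle @ [x] @ replicate n Idle)"
  then obtain \<alpha> n1 n2 n3 where \<alpha>: "\<alpha> \<in> requests \<union> offers" and
    "replicate m Idle @ [x] @ replicate n Idle =
      replicate n1 Idle @ [\<alpha>] @ replicate n2 Idle @ [co \<alpha>] @ replicate n3 Idle"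
    unfolding is_match_def match_on_def by blast
  then have "filter (\<lambda>y. y \<noteq> Idle) (replicate m Idle @ [x] @ replicate n Idle) =
      filter (\<lambda>y. y \<noteq> Idle) (replicate n1 Idle @ [\<alpha>] @ replicate n2 Idle @ [co \<alpha>] @ replicate n3 Idle)"
    by simp
  then show False using \<alpha> assms by (auto simp: requests_def offers_def)
qed

lemma observable_single:
  "x \<noteq> Idle \<Longrightarrow> observable (replicate m Idle @ [x] @ replicate n Idle) = Act x"
  using not_is_match_single[of x m n] by (simp add: observable_def)

section \<open>Local and global moves\<close>

lemma ca_rank_clause_ca [simp]: "ca_rank (clause_ca c) = 1"
  by (cases c) auto

lemma clause_ca_state: "q \<in> ca_states (clause_ca c) \<Longrightarrow> q = [hd q]"
  by (cases c) auto

lemma clause_ca_trans: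
  "(q, v, q') \<in> ca_trans (clause_ca c) \<Longrightarrow> \<exists>x s. x \<noteq> Idle \<and> v = [x] \<and> q' = [s]"
  by (cases c) (auto simp: request_trans_def)

lemma clause_ca_request:
  "([s], [Req a], [s']) \<in> ca_trans (clause_ca c) \<Longrightarrow>
    \<exists>j < length (antecedents c). a = antecedents c ! j \<and> s = insert (Some j) s'"
  by (cases c) (auto simp: request_trans_def)

text \<open>The last hypothesis says that the antecedents already consumed are available. An
  ordinary implication offers only in \<open>star\<close>, where all of them have been consumed; the
  other clauses offer nothing but available atoms. Every offer is a loop.\<close>

lemma clause_ca_offer:
  assumes "([s], [Off a], [s']) \<in> ca_trans (clause_ca c)" "c \<in> set p"
    and "\<And>j. j < length (antecedents c) \<Longrightarrow> Some j \<notin> s \<Longrightarrow> antecedents c ! j \<in> avail p"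
  shows "a \<in> avail p \<and> s' = s"
proof (cases c)
  case (Impl as b)
  then have [simp]: "a = b" "s = star" "s' = star" using assms(1) by (auto simp: request_trans_def)
  have "a' \<in> avail p" if "a' \<in> set as" for a'
    using that assms(3) Impl by (auto simp: star_def in_set_conv_nth)
  then show ?thesis using assms(2) Impl by (auto intro: avail.impl)
qed (use assms in \<open>auto simp: request_trans_def intro: avail.intros\<close>)

lemma map_singleton_update: "(map (\<lambda>s. [s]) q)[i := [s]] = map (\<lambda>s. [s]) (q[i := s])"
  by (rule map_update[symmetric])

text \<open>All components have rank 1, so the nested lists of the product collapse and
  \<open>q\<close> simply lists the local states. In a joint move \<open>i\<close> is always the
  requesting and \<open>j\<close> the offering component, whichever stands first.\<close>

lemma hpcl_ca_trans_cases:
  assumes "(q, v, q') \<in> ca_trans (hpcl_ca p)" "length q = length p"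
  obtains (joint) i j x s t where "i \<noteq> j" "i < length p" "j < length p" "q' = q[i := s, j := t]"
      "([q ! i], [Req x], [s]) \<in> ca_trans (clause_ca (p ! i))"
      "([q ! j], [Off x], [t]) \<in> ca_trans (clause_ca (p ! j))"
    | (single) i m n x s where "i < length p" "q' = q[i := s]" "x \<noteq> Idle"
      "v = replicate m Idle @ [x] @ replicate n Idle"
      "([q ! i], [x], [s]) \<in> ca_trans (clause_ca (p ! i))"
proof -
  have states: "\<exists>ss. qs = map (\<lambda>s. [s]) ss"
    if "qs \<in> listset (map ca_states (map clause_ca p))" for qs
  proof
    show "qs = map (\<lambda>s. [s]) (map hd qs)"
    proof (rule nth_equalityI)
      fix i assume i: "i < length qs"
      with that have "qs ! i \<in> ca_states (clause_ca (p ! i))"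
        by (auto simp: listset_iff list_all2_conv_all_nth)
      from clause_ca_state[OF this] show "qs ! i = map (\<lambda>s. [s]) (map hd qs) ! i"
        using i by (simp only: nth_map length_map)
    qed simp
  qed
  from assms(1)[unfolded hpcl_ca_eq] consider
    (two) qs i j a b r r' where "q = concat qs" "q' = concat (qs[i := r, j := r'])"
      "qs \<in> listset (map ca_states (map clause_ca p))" "i < j" "j < length p"
      "(qs ! i, a, r) \<in> ca_trans (clause_ca (p ! i))"
      "(qs ! j, b, r') \<in> ca_trans (clause_ca (p ! j))" "a \<bowtie> b"
  | (one) qs i a r where "q = concat qs" "q' = concat (qs[i := r])"
      "v = replicate (\<Sum>k<i. ca_rank (map clause_ca p ! k)) Idle @ a @
        replicate (\<Sum>k=Suc i..<length p. ca_rank (map clause_ca p ! k)) Idle"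
      "qs \<in> listset (map ca_states (map clause_ca p))" "i < length p"
      "(qs ! i, a, r) \<in> ca_trans (clause_ca (p ! i))"
    by (auto simp: ca_product_def)
  then show ?thesis
  proof cases
    case two
    obtain ss where "qs = map (\<lambda>s. [s]) ss" using states[OF two(3)] by blast
    moreover from this have "ss = q" using two(1) by simp
    ultimately have qs: "qs = map (\<lambda>s. [s]) q" by simp
    obtain x s where x: "a = [x]" "r = [s]" using clause_ca_trans[OF two(6)] by blast
    obtain y t where y: "b = [y]" "r' = [t]" using clause_ca_trans[OF two(7)] by blast
    \<comment> \<open>Both orders of the updates are prepared, as the request may come from the left
      or from the right component.\<close>
    have q': "q' = q[i := s, j := t]" "q' = q[j := t, i := s]"
      using two(2,4) x y qs
      by (simp_all add: map_singleton_update list_update_swap del: map_update)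
    have tr: "([q ! i], [x], [s]) \<in> ca_trans (clause_ca (p ! i))"
      "([q ! j], [y], [t]) \<in> ca_trans (clause_ca (p ! j))"
      using two x y qs assms(2) by auto
    from two(8) consider z where "x = Req z" "y = Off z" | z where "x = Off z" "y = Req z"
      unfolding x y complementary_single by blast
    then show ?thesis
      using joint[OF _ _ _ q'(1)] joint[OF _ _ _ q'(2)] tr two(4,5) by cases auto
  next
    case one
    obtain ss where "qs = map (\<lambda>s. [s]) ss" using states[OF one(4)] by blast
    moreover from this have "ss = q" using one(1) by simp
    ultimately have qs: "qs = map (\<lambda>s. [s]) q" by simp
    obtain x s where x: "x \<noteq> Idle" "a = [x]" "r = [s]" using clause_ca_trans[OF one(6)] by blast
    have "q' = q[i := s]"
      using one(2) x qs by (simp add: map_singleton_update del: map_update)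
    then show ?thesis using single[of i s x] one(3,5,6) x qs assms(2) by auto
  qed
qed

lemma replicate_match:
  assumes "x = Req a \<and> y = Off a \<or> x = Off a \<and> y = Req a"
  shows "is_match (replicate l Idle @ [x] @ replicate m Idle @ [y] @ replicate n Idle)"
proof -
  have x: "x \<in> requests \<union> offers" and y: "y = co x"
    using assms by (auto simp: requests_def offers_def)
  show ?thesis unfolding is_match_def match_on_def y
    by (rule exI[of _ x], rule conjI[OF x], intro exI) (rule refl)
qed

lemma hpcl_ca_joint:
  assumes "i < j" "j < length p" "list_all2 (\<lambda>s c. [s] \<in> ca_states (clause_ca c)) q p"
    and tr: "([q ! i], [x], [s]) \<in> ca_trans (clause_ca (p ! i))"
      "([q ! j], [y], [t]) \<in> ca_trans (clause_ca (p ! j))"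
    and xy: "x = Req a \<and> y = Off a \<or> x = Off a \<and> y = Req a"
  shows "\<exists>v. is_match v \<and> length v = length p \<and> (q, v, q[i := s, j := t]) \<in> ca_trans (hpcl_ca p)"
proof -
  let ?v = "replicate i Idle @ [x] @ replicate (j - Suc i) Idle @ [y] @ replicate (length p - Suc j) Idle"
  let ?qs = "map (\<lambda>s. [s]) q"
  have l: "length q = length p" using assms(3) by (rule list_all2_lengthD)
  \<comment> \<open>Every rank is 1, so the padding sums of the product are lengths of index
    intervals.\<close>
  have r: "(\<Sum>k=m..<n. ca_rank (map clause_ca p ! k)) = n - m" if "n \<le> length p" for m n
    using that by simp
  have "(q, ?v, q[i := s, j := t]) \<in> ca_trans (hpcl_ca p)"
    unfolding hpcl_ca_eq ca_product_def ca.simps lessThan_atLeast0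
    apply (rule UnI1, rule CollectI)
    apply (rule exI[of _ ?qs], rule exI[of _ i], rule exI[of _ j], rule exI[of _ "[x]"],
        rule exI[of _ "[y]"], rule exI[of _ "[s]"], rule exI[of _ "[t]"])
    using assms l
    by (auto simp: r listset_iff list_all2_conv_all_nth complementary_single
        map_singleton_update simp del: map_update)
  moreover have "is_match ?v" using xy by (rule replicate_match)
  moreover have "length ?v = length p" using assms(1,2) by simp
  ultimately show ?thesis by blast
qed

section \<open>Agreement\<close>

text \<open>Invariant: an index missing from a local state belongs to an available atom. A joint
  move removes one index, whose atom is being offered and hence available; a move of a single
  component must be an offer, which changes no state.\<close>

lemma ca_path_avail:
  assumes "ca_path (hpcl_ca p) q w q'" "w \<in> agreement" "length q = length p"
    and "\<And>k j. k < length p \<Longrightarrow> j < length (antecedents (p ! k)) \<Longrightarrow> Some j \<notin> q ! k \<Longrightarrow>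
      antecedents (p ! k) ! j \<in> avail p"
    and "k < length p" "j < length (antecedents (p ! k))" "Some j \<notin> q' ! k"
  shows "antecedents (p ! k) ! j \<in> avail p"
  using assms
proof (induction arbitrary: k j rule: ca_path.induct)
  case (Cons q v q' w q'')
  have w: "w \<in> agreement" using Cons.prems(1) by (auto simp: agreement_def)
  have obs: "observable v \<in> Act ` offers \<union> {Tau}" using Cons.prems(1) by (auto simp: agreement_def)
  have off: "x \<in> avail p \<and> t = q ! j"
    if "([q ! j], [Off x], [t]) \<in> ca_trans (clause_ca (p ! j))" "j < length p" for x t j
    using that Cons.prems(3) by (intro clause_ca_offer) auto
  have "length q' = length p \<and> (\<forall>k < length p. \<forall>j < length (antecedents (p ! k)). Some j \<notin> q' ! k \<longrightarrow>
      antecedents (p ! k) ! j \<in> avail p)"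
    using Cons.hyps(1) Cons.prems(2)
  proof (cases rule: hpcl_ca_trans_cases)
    case (joint i k x s t)
    have x: "x \<in> avail p" "t = q ! k" using off[OF joint(6,3)] by auto
    \<comment> \<open>The offering component loops, so only the requesting one changes.\<close>
    have q': "q' = q[i := s]" using joint(1,4) x(2) list_update_id[of "q[i := s]" k] by simp
    obtain m where m: "m < length (antecedents (p ! i))" "x = antecedents (p ! i) ! m" "q ! i = insert (Some m) s"
      using clause_ca_request[OF joint(5)] by blast
    have "antecedents (p ! l) ! j \<in> avail p"
      if "l < length p" "j < length (antecedents (p ! l))" "Some j \<notin> q' ! l" for l j
    \<comment> \<open>The only index newly missing is \<open>m\<close> in component
      \<open>i\<close>; its atom \<open>x\<close> is available. All others were missing
      before.\<close>
    proof (cases "l = i \<and> j = m")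
      case False
      then have "Some j \<notin> q ! l"
        using that m(3) Cons.prems(2) by (cases "l = i") (auto simp: q')
      then show ?thesis using that Cons.prems(3) by blast
    qed (use x m in auto)
    then show ?thesis using q' Cons.prems(2) by auto
  next
    case (single i m n x s)
    have "observable v = Act x" unfolding single(4) by (rule observable_single[OF single(3)])
    then obtain a where x: "x = Off a" using obs by (auto simp: offers_def)
    have "q' = q" using single(2) off[OF single(5)[unfolded x] single(1)] by simp
    then show ?thesis using Cons.prems by auto
  qed
  then show ?case using Cons.IH[OF w] Cons.prems(4-) by blast
qed auto

lemma ca_init_hpcl_ca:
  "ca_init (hpcl_ca p) = map (\<lambda>c. idx_state {..<length (antecedents c)}) p"
proof -
  have "ca_init (clause_ca c) = [idx_state {..<length (antecedents c)}]" for c :: "'a clause"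
    by (cases c) (auto simp: star_def idx_state_def)
  then have "map ca_init (map clause_ca p) = map (\<lambda>s. [s]) (map (\<lambda>c. idx_state {..<length (antecedents c)}) p)"
    by simp
  then show ?thesis unfolding hpcl_ca_eq ca_product_def ca.simps by (simp only: concat_map_singleton) simp
qed

lemma ca_final_hpcl_ca: "ca_final (hpcl_ca p) = {replicate (length p) star}"
proof -
  have "ca_final (clause_ca c) = {[star]}" for c :: "'a clause" by (cases c) auto
  then have "listset (map ca_final (map clause_ca p)) = {replicate (length p) [star]}"
    by (auto simp: listset_iff list_all2_conv_all_nth intro!: nth_equalityI)
  moreover have "concat (replicate n [s]) = replicate n s" for n and s :: pstate
    by (induction n) auto
  ultimately show ?thesis by (simp add: hpcl_ca_eq ca_product_def)
qed

lemma all_avail_if_agreement: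
  assumes "admits_agreement (hpcl_ca p)"
  shows "all_avail p"
proof -
  obtain w where w: "w \<in> agreement"
    "ca_path (hpcl_ca p) (ca_init (hpcl_ca p)) w (replicate (length p) star)"
    using assms by (auto simp: admits_agreement_def ca_language_def ca_final_hpcl_ca)
  \<comment> \<open>No index is missing initially, so the invariant starts out vacuously; in
    \<open>star\<close> every index is missing, so it covers all antecedents.\<close>
  have "antecedents (p ! k) ! j \<in> avail p"
    if "k < length p" "j < length (antecedents (p ! k))" for k j
    using w(2,1) by (rule ca_path_avail) (use that in \<open>auto simp: ca_init_hpcl_ca idx_state_def star_def\<close>)
  then show ?thesis unfolding all_avail_iff by (metis in_set_conv_nth subsetI)
qed

section \<open>Construction of an accepting run of matches\<close>

definition hpcl_state :: "'a hpcl \<Rightarrow> pstate list \<Rightarrow> bool" where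
  "hpcl_state p q \<longleftrightarrow> list_all2 (\<lambda>s c. [s] \<in> ca_states (clause_ca c)) q p"

lemma clause_ca_states: "[s] \<in> ca_states (clause_ca c) \<longleftrightarrow> s \<in> pstates (antecedents c)"
  by (cases c) (auto simp: pstates_def star_def idx_state_def)

lemma pstatesD:
  assumes "s \<in> pstates as"
  shows "finite s" "None \<in> s" "Some j \<in> s \<Longrightarrow> j < length as" "s - {Some j} \<in> pstates as"
    "s \<noteq> star \<Longrightarrow> \<exists>j. Some j \<in> s"
proof -
  obtain J where J: "J \<subseteq> {..<length as}" "s = idx_state J" using assms by (auto simp: pstates_def)
  then show "finite s" using finite_subset[OF J(1)] by (simp add: idx_state_def)
  show "None \<in> s" "Some j \<in> s \<Longrightarrow> j < length as" using J by (auto simp: idx_state_def)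
  show "s \<noteq> star \<Longrightarrow> \<exists>j. Some j \<in> s" using J by (auto simp: idx_state_def star_def)
  have "s - {Some j} = idx_state (J - {j})" using J by (auto simp: idx_state_def)
  then show "s - {Some j} \<in> pstates as" using J by (auto simp: pstates_def)
qed

lemma clause_ca_consume:
  assumes "s \<in> pstates (antecedents c)" "Some j \<in> s"
  shows "([s], [Req (antecedents c ! j)], [s - {Some j}]) \<in> ca_trans (clause_ca c)"
proof -
  have "s = insert (Some j) (s - {Some j})" "Some j \<notin> s - {Some j}" using assms(2) by auto
  then have "([s], [Req (antecedents c ! j)], [s - {Some j}]) \<in> request_trans (antecedents c)"
    unfolding request_trans_def using pstatesD(3)[OF assms] pstatesD(4)[OF assms(1)]
    by (intro CollectI exI[of _ j] exI[of _ "s - {Some j}"]) simp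
  moreover have "antecedents c \<noteq> []" using pstatesD(3)[OF assms] by auto
  ultimately show ?thesis by (cases c) auto
qed

text \<open>Source and target coincide because every offer of a clause automaton is a loop; a match
  with such an offer therefore changes only the requesting component.\<close>

definition offered :: "'a hpcl \<Rightarrow> pstate list \<Rightarrow> 'a set" where
  "offered p q = {a. \<exists>k < length p. ([q ! k], [Off a], [q ! k]) \<in> ca_trans (clause_ca (p ! k))}"

lemma offeredI:
  "k < length p \<Longrightarrow> ([q ! k], [Off a], [q ! k]) \<in> ca_trans (clause_ca (p ! k)) \<Longrightarrow> a \<in> offered p q"
  by (auto simp: offered_def)

text \<open>If no pending request could be matched, induction on \<open>avail\<close> would show
  every available atom to be offered. Pending requests ask for antecedents, all of which are
  available, so one of them could be matched after all.\<close>

lemma hpcl_ca_progress: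
  assumes p: "is_hpcl p" "all_avail p" and q: "hpcl_state p q" "q \<noteq> replicate (length p) star"
  shows "\<exists>i < length p. \<exists>j. Some j \<in> q ! i \<and>
    (\<exists>v. is_match v \<and> length v = length p \<and> (q, v, q[i := q ! i - {Some j}]) \<in> ca_trans (hpcl_ca p))"
proof -
  have len: "length q = length p" using q(1) by (auto simp: hpcl_state_def dest: list_all2_lengthD)
  have st: "q ! k \<in> pstates (antecedents (p ! k))" if "k < length p" for k
    using q(1) that by (auto simp: hpcl_state_def clause_ca_states list_all2_conv_all_nth)
  have "\<exists>i < length p. \<exists>j. Some j \<in> q ! i \<and> antecedents (p ! i) ! j \<in> offered p q"
  proof (rule ccontr)
    assume stuck: "\<not> ?thesis"
    have "a \<in> offered p q" if "a \<in> avail p" for a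
      using that
    proof induction
      case (facts as a)
      then obtain k where k: "k < length p" "p ! k = Facts as" by (auto simp: in_set_conv_nth)
      moreover have "q ! k = star" using st[OF k(1)] k(2) by (simp add: pstates_def star_def idx_state_def)
      moreover have "([star], [Off a], [star]) \<in> ca_trans (clause_ca (Facts as))"
        using facts(2) by (auto simp: in_set_conv_nth)
      ultimately show ?case by (intro offeredI[of k]) simp_all
    next
      case (cimpl as b)
      then obtain k where k: "k < length p" "p ! k = CImpl as b" by (auto simp: in_set_conv_nth)
      then show ?case using st[OF k(1)] by (intro offeredI[of k]) auto
    next
      case (impl as b)
      then obtain k where k: "k < length p" "p ! k = Impl as b" by (auto simp: in_set_conv_nth)
      \<comment> \<open>By induction all antecedents of this clause are offered; a pending index
        would be a matchable request, so none is left and the clause offers its conclusion.\<close>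
      have "q ! k = star"
      proof (rule ccontr)
        assume "q ! k \<noteq> star"
        then obtain j where j: "Some j \<in> q ! k" using pstatesD(5) st[OF k(1)] by blast
        then have "j < length as" using pstatesD(3)[OF st[OF k(1)]] k by auto
        then have "antecedents (p ! k) ! j \<in> offered p q" using impl(3) k(2) by auto
        then show False using stuck j k(1) by blast
      qed
      then show ?case using k by (intro offeredI[of k]) auto
    qed
    then have off: "set (antecedents c) \<subseteq> offered p q" if "c \<in> set p" for c
      using p(2) that unfolding all_avail_iff by blast
    obtain k where k: "k < length p" "q ! k \<noteq> star"
      using q(2) len by (auto simp: list_eq_iff_nth_eq)
    obtain j where j: "Some j \<in> q ! k" using pstatesD(5)[OF st[OF k(1)] k(2)] by blast
    then have "antecedents (p ! k) ! j \<in> set (antecedents (p ! k))" using pstatesD(3)[OF st[OF k(1)]] by simp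
    then show False using stuck off[of "p ! k"] j k(1) by auto
  qed
  then obtain i j k where i: "i < length p" "Some j \<in> q ! i" and k: "k < length p"
    "([q ! k], [Off (antecedents (p ! i) ! j)], [q ! k]) \<in> ca_trans (clause_ca (p ! k))"
    by (auto simp: offered_def)
  let ?a = "antecedents (p ! i) ! j"
  have req: "([q ! i], [Req ?a], [q ! i - {Some j}]) \<in> ca_trans (clause_ca (p ! i))"
    using clause_ca_consume[OF st[OF i(1)] i(2)] .
  \<comment> \<open>A match needs two distinct components. By \<open>clause_ok\<close>, no clause
    offers an atom that it also requests.\<close>
  have "i \<noteq> k"
  proof
    assume "i = k"
    have "?a \<in> set (antecedents (p ! i))" using pstatesD(3)[OF st[OF i(1)] i(2)] by simp
    moreover have "clause_ok (p ! i)" using p(1) i(1) by (simp add: is_hpcl_def)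
    ultimately show False
      using k(2) unfolding \<open>i = k\<close>[symmetric] by (cases "p ! i") (auto simp: request_trans_def)
  qed
  then consider "i < k" | "k < i" by linarith
  then have "\<exists>v. is_match v \<and> length v = length p \<and> (q, v, q[i := q ! i - {Some j}]) \<in> ca_trans (hpcl_ca p)"
  proof cases
    case 1
    \<comment> \<open>After swapping, the update at \<open>k\<close> writes back
      \<open>q ! k\<close> and disappears.\<close>
    from hpcl_ca_joint[OF 1 k(1) q(1)[unfolded hpcl_state_def] req k(2)] show ?thesis
      using 1 by (simp add: list_update_swap)
  next
    case 2
    from hpcl_ca_joint[OF 2 i(1) q(1)[unfolded hpcl_state_def] k(2) req] show ?thesis by simp
  qed
  then show ?thesis using i by blast
qed

lemma hpcl_ca_run:
  assumes "is_hpcl p" "all_avail p" "hpcl_state p q"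
  shows "\<exists>w. ca_path (hpcl_ca p) q w (replicate (length p) star) \<and>
    (\<forall>v \<in> set w. is_match v \<and> length v = length p)"
  using assms(3)
\<comment> \<open>Each match removes one pending index, so the total size of the local states
  decreases strictly.\<close>
proof (induction "\<Sum>k<length p. card (q ! k)" arbitrary: q rule: less_induct)
  case less
  show ?case
  proof (cases "q = replicate (length p) star")
    case True
    then show ?thesis by (intro exI[of _ "[]"]) (auto intro: ca_path.Nil)
  next
    case False
    then obtain i j v where i: "i < length p" "Some j \<in> q ! i" and v: "is_match v" "length v = length p"
      "(q, v, q[i := q ! i - {Some j}]) \<in> ca_trans (hpcl_ca p)" (is "(_, _, ?q') \<in> _")
      using hpcl_ca_progress[OF assms(1,2) less.prems] by blast
    have len: "length q = length p"
      using less.prems by (auto simp: hpcl_state_def dest: list_all2_lengthD)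
    have st: "q ! i \<in> pstates (antecedents (p ! i))"
      using less.prems i(1) by (auto simp: hpcl_state_def clause_ca_states list_all2_conv_all_nth)
    have "card (?q' ! i) < card (q ! i)"
      using card_Diff1_less[OF pstatesD(1)[OF st] i(2)] i(1) len by simp
    moreover have "card (?q' ! k) \<le> card (q ! k)" for k
      using calculation by (cases "k = i") auto
    ultimately have "(\<Sum>k<length p. card (?q' ! k)) < (\<Sum>k<length p. card (q ! k))"
      using i(1) by (intro sum_strict_mono_ex1) auto
    moreover have "hpcl_state p ?q'"
      using less.prems i(1) pstatesD(4)[OF st]
      by (auto simp: hpcl_state_def clause_ca_states list_all2_conv_all_nth nth_list_update)
    ultimately obtain w where "ca_path (hpcl_ca p) ?q' w (replicate (length p) star)"
      "\<forall>v \<in> set w. is_match v \<and> length v = length p"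
      using less.hyps by blast
    then show ?thesis using v by (intro exI[of _ "v # w"]) (auto intro: ca_path.Cons)
  qed
qed

lemma agreement_if_all_avail:
  assumes "is_hpcl p" "all_avail p"
  shows "admits_agreement (hpcl_ca p)"
proof -
  have "hpcl_state p (ca_init (hpcl_ca p))"
    by (auto simp: hpcl_state_def ca_init_hpcl_ca clause_ca_states list_all2_conv_all_nth)
  then obtain w where w: "ca_path (hpcl_ca p) (ca_init (hpcl_ca p)) w (replicate (length p) star)"
    "\<forall>v \<in> set w. is_match v \<and> length v = length p"
    using hpcl_ca_run[OF assms] by blast
  \<comment> \<open>The rank is the number of clauses, and \<open>agreement\<close> demands a rank
    above 1.\<close>
  have "1 < length p" using assms(1) by (simp add: is_hpcl_def)
  then have "w \<in> agreement"
    using w(2) by (auto simp: agreement_def observable_def intro!: exI[of _ "length p"])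
  with w(1) show ?thesis by (auto simp: admits_agreement_def ca_language_def ca_final_hpcl_ca)
qed

theorem theorem5p6:
  fixes p :: "'a hpcl"
  assumes "is_hpcl p"
  shows "{hpcl_form p} \<turnstile> lambda_form p \<longleftrightarrow> admits_agreement (hpcl_ca p)"
  using all_avail_if_provable provable_if_all_avail all_avail_if_agreement
    agreement_if_all_avail[OF assms] by blast

end
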